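(* Suppose that both of the following statements hold: (i) every vertex-transitive graph $H$ has strong chromatic number $s\chi(H) \le \frac{5}{2}\Delta(H)$; (ii) every vertex-transitive graph $H$ satisfies $\chi(H) \le \left\lceil \frac{\omega(H) + \Delta(H) + 1}{2} \right\rceil$. Then every vertex-transitive graph $G$ satisfies $\chi(G) \le \max\left\{\omega(G),\, \left\lceil \frac{5\Delta(G) + 3}{6} \right\rceil\right\}$.
   Context: A graph is vertex-transitive if its automorphism group acts transitively on its vertices. $\chi$, $\omega$, $\Delta$ denote the chromatic number, clique number and maximum degree, and $|G|$ denotes the number of vertices of $G$. For a positive integer $r$, a graph $G$ with $|G| = rk$ ($k$ an integer) is strongly $r$-colorable if for every partition of $V(G)$ into parts of size $r$ there is a proper coloring of $G$ that uses all $r$ colors on each part. If $|G|$ is not a multiple of $r$, then $G$ is strongly $r$-colorable if and only if the graph formed by adding $r\lceil |G|/r \rceil - |G|$ isolated vertices to $G$ is strongly $r$-colorable. The strong chromatic number $s\chi(G)$ is the smallest $r$ for which $G$ is strongly $r$-colorable. *)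

theory Defs
  imports Complex_Main "HOL-Library.Disjoint_Sets" "Graph_Theory.Pair_Digraph"
    "Graph_Theory.Digraph_Isomorphism"
begin

text \<open>
  Finite simple graphs are the pair graphs of the Graph Theory library: finite vertex set,
  symmetric, loop-free arc relation, so each edge appears as two opposite arcs.
\<close>

text \<open>
  The automorphisms of \<open>G\<close> are the library's digraph isomorphisms \<open>f\<close> carrying \<open>G\<close> to itself;
  see \<open>vertex_transitive_iff\<close> below for the formulation by vertex bijections.
\<close>

definition vertex_transitive :: "'a pair_pre_digraph \<Rightarrow> bool" where
  "vertex_transitive G \<longleftrightarrow>
     (\<forall>u\<in>pverts G. \<forall>v\<in>pverts G.
        \<exists>f. pre_digraph.digraph_isomorphism (with_proj G) f
            \<and> app_iso f (with_proj G) = with_proj G \<and> iso_verts f u = v)"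

text \<open>The \<open>insert 0\<close> only matters for the graph without vertices.\<close>

definition max_degree :: "'a pair_pre_digraph \<Rightarrow> nat" where
  "max_degree G = Max (insert 0 (out_degree (with_proj G) ` pverts G))"

definition clique :: "'a pair_pre_digraph \<Rightarrow> 'a set \<Rightarrow> bool" where
  "clique G K \<longleftrightarrow> K \<subseteq> pverts G \<and> pairwise (\<lambda>u v. (u, v) \<in> parcs G) K"

definition clique_number :: "'a pair_pre_digraph \<Rightarrow> nat" where
  "clique_number G = Max {card K | K. clique G K}"

definition proper_coloring :: "'a pair_pre_digraph \<Rightarrow> nat \<Rightarrow> ('a \<Rightarrow> nat) \<Rightarrow> bool" where
  "proper_coloring G r c \<longleftrightarrow>
     c ` pverts G \<subseteq> {..<r} \<and> (\<forall>(u, v)\<in>parcs G. c u \<noteq> c v)"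

definition chromatic_number :: "'a pair_pre_digraph \<Rightarrow> nat" where
  "chromatic_number G = (LEAST r. \<exists>c. proper_coloring G r c)"

text \<open>The condition below is meant for \<open>r > 0\<close> dividing the number of vertices.\<close>

definition strongly_colorable_mult :: "nat \<Rightarrow> 'a pair_pre_digraph \<Rightarrow> bool" where
  "strongly_colorable_mult r G \<longleftrightarrow>
     (\<forall>P. partition_on (pverts G) P \<and> (\<forall>X\<in>P. card X = r) \<longrightarrow>
        (\<exists>c. proper_coloring G r c \<and> (\<forall>X\<in>P. c ` X = {..<r})))"

definition add_isolated :: "nat \<Rightarrow> 'a pair_pre_digraph \<Rightarrow> ('a + nat) pair_pre_digraph" where
  "add_isolated m G =
     \<lparr> pverts = Inl ` pverts G \<union> Inr ` {..<m}, parcs = map_prod Inl Inl ` parcs G \<rparr>"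

definition strongly_colorable :: "nat \<Rightarrow> 'a pair_pre_digraph \<Rightarrow> bool" where
  "strongly_colorable r G \<longleftrightarrow>
     (if r dvd card (pverts G) then strongly_colorable_mult r G
      else strongly_colorable_mult r
             (add_isolated (r * nat \<lceil>real (card (pverts G)) / real r\<rceil> - card (pverts G)) G))"

text \<open>
  Since \<open>r\<close> is positive, a graph with vertices but no edges has strong chromatic number 1,
  so a bound by a multiple of the maximum degree is only sensible for graphs with an edge.
\<close>

definition strong_chromatic_number :: "'a pair_pre_digraph \<Rightarrow> nat" where
  "strong_chromatic_number G = (LEAST r. r > 0 \<and> strongly_colorable r G)"

lemma vertex_transitive_iff:
  assumes "pair_graph G"
  shows "vertex_transitive G \<longleftrightarrow>
    (\<forall>u\<in>pverts G. \<forall>v\<in>pverts G. \<exists>f. bij_betw f (pverts G) (pverts G) \<and> f u = v \<and>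
       (\<forall>x\<in>pverts G. \<forall>y\<in>pverts G. (f x, f y) \<in> parcs G \<longleftrightarrow> (x, y) \<in> parcs G))"
proof -
  interpret pair_graph G by fact
  have "(\<exists>f. pre_digraph.digraph_isomorphism (with_proj G) f
            \<and> app_iso f (with_proj G) = with_proj G \<and> iso_verts f u = v) \<longleftrightarrow>
        (\<exists>f. bij_betw f (pverts G) (pverts G) \<and> f u = v \<and>
       (\<forall>x\<in>pverts G. \<forall>y\<in>pverts G. (f x, f y) \<in> parcs G \<longleftrightarrow> (x, y) \<in> parcs G))"
    (is "?L \<longleftrightarrow> ?R") for u v
  proof
    assume ?L
    then obtain f where iso: "pre_digraph.digraph_isomorphism (with_proj G) f"
      and app: "app_iso f (with_proj G) = with_proj G" and uv: "iso_verts f u = v" by blast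
    from app have V: "iso_verts f ` pverts G = pverts G" and A: "iso_arcs f ` parcs G = parcs G"
      and t: "iso_tail f = fst" and h: "iso_head f = snd"
      by (simp_all add: app_iso_def with_proj_def)
    have inj: "inj_on (iso_verts f) (pverts G)"
      using iso by (simp add: pre_digraph.digraph_isomorphism_def)
    have arc: "iso_arcs f (x, y) = (iso_verts f x, iso_verts f y)" if "(x, y) \<in> parcs G" for x y
      using iso that t h by (force simp: pre_digraph.digraph_isomorphism_def prod_eq_iff)
    have "(iso_verts f x, iso_verts f y) \<in> parcs G \<longleftrightarrow> (x, y) \<in> parcs G"
      if xy: "x \<in> pverts G" "y \<in> pverts G" for x y
    proof
      assume "(iso_verts f x, iso_verts f y) \<in> parcs G"
      then obtain x' y' where *: "(x', y') \<in> parcs G"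
        "iso_arcs f (x', y') = (iso_verts f x, iso_verts f y)"
        using A by (metis imageE surj_pair)
      with arc have "iso_verts f x' = iso_verts f x" "iso_verts f y' = iso_verts f y" by auto
      with * inj xy show "(x, y) \<in> parcs G" by (metis inj_onD wellformed')
    next
      assume "(x, y) \<in> parcs G" then show "(iso_verts f x, iso_verts f y) \<in> parcs G"
        using A arc by (metis image_eqI)
    qed
    then show ?R using inj V uv by (auto simp: bij_betw_def)
  next
    assume ?R
    then obtain f where f: "bij_betw f (pverts G) (pverts G)" "f u = v"
      "\<And>x y. x \<in> pverts G \<Longrightarrow> y \<in> pverts G \<Longrightarrow> (f x, f y) \<in> parcs G \<longleftrightarrow> (x, y) \<in> parcs G"
      by blast
    let ?h = "\<lparr> iso_verts = f, iso_arcs = map_prod f f, iso_head = snd, iso_tail = fst \<rparr>"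
    have inj: "inj_on f (pverts G)" and V: "f ` pverts G = pverts G"
      using f(1) by (auto simp: bij_betw_def)
    have A: "map_prod f f ` parcs G = parcs G"
    proof (intro equalityI subsetI)
      fix e assume "e \<in> map_prod f f ` parcs G" then show "e \<in> parcs G"
        using f(3) wellformed' by fastforce
    next
      fix e assume e: "e \<in> parcs G"
      obtain a b where ab: "e = (a, b)" by fastforce
      with e have "a \<in> f ` pverts G" "b \<in> f ` pverts G" using V wellformed' by auto
      then obtain x y where "a = f x" "b = f y" "x \<in> pverts G" "y \<in> pverts G" by auto
      with e ab f(3) show "e \<in> map_prod f f ` parcs G" by force
    qed
    have "inj_on (map_prod f f) (parcs G)"
      by (rule inj_on_subset[OF map_prod_inj_on[OF inj inj]]) (auto dest: wellformed')
    then have "pre_digraph.digraph_isomorphism (with_proj G) ?h"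
      using inj wf_digraph_axioms by (auto simp: pre_digraph.digraph_isomorphism_def)
    moreover have "app_iso ?h (with_proj G) = with_proj G"
      using V A by (simp add: app_iso_def with_proj_def)
    ultimately show ?L using f(2) by (intro exI[of _ ?h]) auto
  qed
  then show ?thesis unfolding vertex_transitive_def by simp
qed

text \<open>The minima defining the two chromatic numbers are over nonempty sets.\<close>

lemma ex_proper_coloring:
  assumes "pair_graph G"
  shows "\<exists>c. proper_coloring G (card (pverts G)) c \<and> c ` pverts G = {..<card (pverts G)}"
proof -
  interpret pair_graph G by fact
  obtain c where c: "bij_betw c (pverts G) {..<card (pverts G)}"
    using ex_bij_betw_finite_nat[OF pair_finite_verts] by (auto simp: atLeast0LessThan)
  have "c u \<noteq> c v" if "(u, v) \<in> parcs G" for u v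
    using that c wellformed'[OF that] pair_no_loops[OF that]
    by (auto simp: bij_betw_def dest: inj_onD)
  with c show ?thesis
    by (intro exI[of _ c]) (auto simp: proper_coloring_def bij_betw_def)
qed

lemma strongly_colorable_card:
  assumes "pair_graph G"
  shows "strongly_colorable (card (pverts G)) G"
proof -
  interpret pair_graph G by fact
  obtain c where c: "proper_coloring G (card (pverts G)) c" "c ` pverts G = {..<card (pverts G)}"
    using ex_proper_coloring[OF assms] by blast
  have "X = pverts G"
    if "partition_on (pverts G) P" "\<forall>X\<in>P. card X = card (pverts G)" "X \<in> P" for P X
    using that pair_finite_verts by (metis card_subset_eq partition_onD1 Union_upper)
  with c show ?thesis
    unfolding strongly_colorable_def strongly_colorable_mult_def by (metis dvd_refl)
qed

end

theory Submission
  imports Defs "HOL-Combinatorics.Transposition"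
begin

text \<open>
  Write \<open>\<chi>\<close>, \<open>\<omega>\<close>, \<open>\<Delta>\<close> for the invariants of \<open>G\<close>. If \<open>3\<omega> \<le> 2(\<Delta> + 1)\<close>, hypothesis (ii) already
  gives \<open>\<chi> \<le> \<lceil>(5\<Delta> + 3) / 6\<rceil>\<close>, by integrality.

  If \<open>3\<omega> > 2(\<Delta> + 1)\<close>, the maximum cliques of \<open>G\<close> are pairwise disjoint
  (\<open>max_cliques_disjoint\<close>). The reason is Hajnal's inequality \<open>|\<Inter>F| + |\<Union>F| \<ge> 2\<omega>\<close> for families
  \<open>F\<close> of maximum cliques: applied to the family \<open>F\<^sub>x\<close> of all maximum cliques through a vertex \<open>x\<close>,
  whose union has at most \<open>\<Delta> + 1\<close> vertices, it makes \<open>\<Inter>F\<^sub>x\<close> occupy more than half of every member.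
  For \<open>x\<close> and \<open>y\<close> in a common maximum clique these two cores therefore meet, and a
  vertex \<open>z\<close> in both has \<open>F\<^sub>x \<subseteq> F\<^sub>z\<close> and \<open>F\<^sub>y \<subseteq> F\<^sub>z\<close>; the families have equal size by
  vertex-transitivity, so \<open>F\<^sub>x = F\<^sub>y\<close>. Thus every member of \<open>F\<^sub>x\<close> contains all vertices of every other
  member, and \<open>F\<^sub>x\<close> is a singleton.

  Hence the maximum cliques partition the vertices. Let \<open>H\<close> arise from \<open>G\<close> by deleting the edges
  inside them. It is vertex-transitive with \<open>\<Delta>(H) \<le> \<Delta> + 1 - \<omega>\<close>, so (i) bounds strong chromatic
  numbers by \<open>5/2 (\<Delta> + 1 - \<omega>) \<le> 5\<Delta>/6\<close>. A proper coloring of \<open>H\<close> that is injective on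
  every maximum clique is a proper coloring of \<open>G\<close>, and such a coloring with \<open>max s \<omega>\<close>
  colors is what strong \<open>s\<close>-colorability should provide.

  The difficulty is that the cliques have \<open>\<omega>\<close> rather than \<open>s\<close> vertices, and that only fewer
  than \<open>s\<close> isolated vertices are available for padding. Both are overcome by applying (i) not to
  \<open>H\<close> but to the disjoint union of many copies of \<open>H\<close>, again vertex-transitive and of the same maximum
  degree. With the number of copies divisible by a large factorial, \<open>s\<close> divides the number of
  vertices, so every system of disjoint \<open>s\<close>-sets extends to a partition and can be colored. In this
  form, for systems that need not cover all vertices, colorability passes from \<open>s\<close> to \<open>s + 1\<close>
  (\<open>system_colorable_Suc\<close>), hence to \<open>max s \<omega>\<close>; and each clique of one copy of \<open>H\<close> can be padded to
  size \<open>max s \<omega>\<close> by its own images in the other copies.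
\<close>

section \<open>Degrees, cliques and colorings\<close>

lemma pair_graphI:
  assumes "finite (pverts G)" "parcs G \<subseteq> pverts G \<times> pverts G"
    and "\<And>u v. (u, v) \<in> parcs G \<Longrightarrow> u \<noteq> v"
    and "\<And>u v. (u, v) \<in> parcs G \<Longrightarrow> (v, u) \<in> parcs G"
  shows "pair_graph G"
proof unfold_locales
  show "finite (parcs G)"
    using assms(1,2) by (meson finite_SigmaI finite_subset)
  show "symmetric (with_proj G)"
    using assms(4) by (auto simp: symmetric_def sym_def)
qed (use assms in auto)

lemma pair_graphD:
  assumes "pair_graph G"
  shows "finite (pverts G)" "parcs G \<subseteq> pverts G \<times> pverts G"
    and "\<And>u v. (u, v) \<in> parcs G \<Longrightarrow> u \<noteq> v"
    and "\<And>u v. (u, v) \<in> parcs G \<Longrightarrow> (v, u) \<in> parcs G"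
proof -
  interpret pair_graph G by fact
  show "finite (pverts G)" "parcs G \<subseteq> pverts G \<times> pverts G"
    by (auto dest: wellformed' intro: pair_finite_verts)
  show "u \<noteq> v" if "(u, v) \<in> parcs G" for u v
    using pair_no_loops[OF that] by simp
  show "(v, u) \<in> parcs G" if "(u, v) \<in> parcs G" for u v
    using that pair_sym_arcs by (auto simp: symmetric_def sym_def)
qed

lemma out_degree_with_proj: "out_degree (with_proj G) v = card (parcs G `` {v})"
proof -
  have "out_arcs (with_proj G) v = Pair v ` (parcs G `` {v})"
    by (auto simp: out_arcs_def)
  then show ?thesis
    by (simp add: out_degree_def card_image inj_on_def)
qed

lemma card_neighbors_le_max_degree:
  assumes "finite (pverts G)" "v \<in> pverts G"
  shows "card (parcs G `` {v}) \<le> max_degree G"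
  using assms by (auto simp: max_degree_def out_degree_with_proj intro!: Max_ge)

lemma max_degree_leI:
  assumes "finite (pverts G)" "\<And>v. v \<in> pverts G \<Longrightarrow> card (parcs G `` {v}) \<le> d"
  shows "max_degree G \<le> d"
  using assms by (auto simp: max_degree_def out_degree_with_proj)

lemma finite_cliques: "finite (pverts G) \<Longrightarrow> finite {K. clique G K}"
  by (rule finite_subset[of _ "Pow (pverts G)"]) (auto simp: clique_def)

lemma card_clique_le:
  assumes "finite (pverts G)" "clique G K"
  shows "card K \<le> clique_number G"
  unfolding clique_number_def
  using finite_cliques[OF assms(1)] assms(2) by (intro Max_ge) auto

lemma ex_clique_card:
  assumes "finite (pverts G)"
  shows "\<exists>K. clique G K \<and> card K = clique_number G"
proof -
  have "clique_number G \<in> {card K | K. clique G K}"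
    unfolding clique_number_def
  proof (rule Max_in)
    show "finite {card K | K. clique G K}"
      using finite_cliques[OF assms] by auto
    have "clique G {}" by (simp add: clique_def)
    then show "{card K | K. clique G K} \<noteq> {}" by blast
  qed
  then show ?thesis by auto
qed

lemma chromatic_number_le: "proper_coloring G r c \<Longrightarrow> chromatic_number G \<le> r"
  unfolding chromatic_number_def by (rule Least_le) blast

lemma ex_coloring_chromatic_number:
  assumes "pair_graph G"
  shows "\<exists>c. proper_coloring G (chromatic_number G) c"
  unfolding chromatic_number_def
  by (rule LeastI[of "\<lambda>r. \<exists>c. proper_coloring G r c"]) (use ex_proper_coloring[OF assms] in blast)

section \<open>Automorphisms, relabelings and disjoint copies\<close>

definition automorphism :: "'a pair_pre_digraph \<Rightarrow> ('a \<Rightarrow> 'a) \<Rightarrow> bool" where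
  "automorphism G f \<longleftrightarrow> bij_betw f (pverts G) (pverts G) \<and>
     (\<forall>x\<in>pverts G. \<forall>y\<in>pverts G. (f x, f y) \<in> parcs G \<longleftrightarrow> (x, y) \<in> parcs G)"

lemma vertex_transitive_iff_automorphism:
  assumes "pair_graph G"
  shows "vertex_transitive G \<longleftrightarrow>
    (\<forall>u\<in>pverts G. \<forall>v\<in>pverts G. \<exists>f. automorphism G f \<and> f u = v)"
  unfolding vertex_transitive_iff[OF assms] automorphism_def by meson

lemma automorphism_inv_into:
  assumes "automorphism G f"
  shows "automorphism G (inv_into (pverts G) f)"
proof -
  let ?g = "inv_into (pverts G) f"
  have f: "bij_betw f (pverts G) (pverts G)" using assms by (simp add: automorphism_def)
  have g: "?g x \<in> pverts G" "f (?g x) = x" if "x \<in> pverts G" for x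
    using f that by (auto simp: bij_betw_def inv_into_into f_inv_into_f)
  have "(?g x, ?g y) \<in> parcs G \<longleftrightarrow> (x, y) \<in> parcs G"
    if "x \<in> pverts G" "y \<in> pverts G" for x y
    using assms g[OF that(1)] g[OF that(2)] unfolding automorphism_def by metis
  then show ?thesis
    using f by (simp add: automorphism_def bij_betw_inv_into)
qed

definition relabel :: "('a \<Rightarrow> 'b) \<Rightarrow> 'a pair_pre_digraph \<Rightarrow> 'b pair_pre_digraph" where
  "relabel f G = \<lparr> pverts = f ` pverts G, parcs = map_prod f f ` parcs G \<rparr>"

lemma relabel_simps [simp]:
  "pverts (relabel f G) = f ` pverts G" "parcs (relabel f G) = map_prod f f ` parcs G"
  by (simp_all add: relabel_def)

lemma relabel_arc_iff:
  assumes "pair_graph G" "inj_on f (pverts G)" "u \<in> pverts G" "v \<in> pverts G"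
  shows "(f u, f v) \<in> parcs (relabel f G) \<longleftrightarrow> (u, v) \<in> parcs G"
proof
  assume "(f u, f v) \<in> parcs (relabel f G)"
  then obtain a b where ab: "(a, b) \<in> parcs G" "f a = f u" "f b = f v" by auto
  then have "a \<in> pverts G" "b \<in> pverts G" using pair_graphD(2)[OF assms(1)] by auto
  with ab assms show "(u, v) \<in> parcs G" by (metis inj_onD)
qed force

lemma pair_graph_relabel:
  assumes "pair_graph G" "inj_on f (pverts G)"
  shows "pair_graph (relabel f G)"
proof (rule pair_graphI)
  note G = pair_graphD[OF assms(1)]
  show "finite (pverts (relabel f G))" using G(1) by simp
  show "parcs (relabel f G) \<subseteq> pverts (relabel f G) \<times> pverts (relabel f G)"
    using G(2) by auto
  show "a \<noteq> b" if "(a, b) \<in> parcs (relabel f G)" for a b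
  proof -
    from that obtain u v where "(u, v) \<in> parcs G" "a = f u" "b = f v" by auto
    then show ?thesis using G(2) G(3)[of u v] assms(2) by (auto dest: inj_onD)
  qed
  show "(b, a) \<in> parcs (relabel f G)" if "(a, b) \<in> parcs (relabel f G)" for a b
    using that G(4) by force
qed

lemma vertex_transitive_relabel:
  assumes G: "pair_graph G" and inj: "inj_on f (pverts G)" and vt: "vertex_transitive G"
  shows "vertex_transitive (relabel f G)"
  unfolding vertex_transitive_iff_automorphism[OF pair_graph_relabel[OF G inj]]
proof (intro ballI)
  fix a b assume "a \<in> pverts (relabel f G)" "b \<in> pverts (relabel f G)"
  then obtain u v where uv: "u \<in> pverts G" "v \<in> pverts G" "a = f u" "b = f v" by auto
  obtain h where h: "automorphism G h" "h u = v"
    using vt uv unfolding vertex_transitive_iff_automorphism[OF G] by blast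
  let ?i = "inv_into (pverts G) f"
  let ?h = "f \<circ> h \<circ> ?i"
  have i: "?i (f x) = x" if "x \<in> pverts G" for x using inj that by simp
  have hb: "bij_betw h (pverts G) (pverts G)" using h by (simp add: automorphism_def)
  have fb: "bij_betw f (pverts G) (f ` pverts G)" using inj by (simp add: bij_betw_def)
  have bij: "bij_betw ?h (f ` pverts G) (f ` pverts G)"
    using bij_betw_trans[OF bij_betw_inv_into[OF fb] bij_betw_trans[OF hb fb]]
    by (simp add: comp_assoc)
  have arc: "(?h (f x), ?h (f y)) \<in> parcs (relabel f G) \<longleftrightarrow> (f x, f y) \<in> parcs (relabel f G)"
    if x: "x \<in> pverts G" and y: "y \<in> pverts G" for x y
  proof -
    have "h x \<in> pverts G" "h y \<in> pverts G" using hb x y by (auto simp: bij_betw_def)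
    then have "(f (h x), f (h y)) \<in> parcs (relabel f G) \<longleftrightarrow> (h x, h y) \<in> parcs G"
      by (rule relabel_arc_iff[OF G inj])
    also have "\<dots> \<longleftrightarrow> (x, y) \<in> parcs G" using h x y by (simp add: automorphism_def)
    also have "\<dots> \<longleftrightarrow> (f x, f y) \<in> parcs (relabel f G)"
      by (rule relabel_arc_iff[OF G inj x y, symmetric])
    finally show ?thesis using i x y by simp
  qed
  have "automorphism (relabel f G) ?h"
    unfolding automorphism_def using bij arc by (auto simp del: relabel_simps(2) o_apply)
  moreover have "?h a = b" using uv h(2) i by simp
  ultimately show "\<exists>g. automorphism (relabel f G) g \<and> g a = b" by blast
qed

lemma max_degree_relabel_le:
  assumes G: "pair_graph G" and inj: "inj_on f (pverts G)"
  shows "max_degree (relabel f G) \<le> max_degree G"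
proof (rule max_degree_leI)
  note D = pair_graphD[OF G]
  show "finite (pverts (relabel f G))" using D(1) by simp
  fix a assume "a \<in> pverts (relabel f G)"
  then obtain v where v: "v \<in> pverts G" "a = f v" by auto
  have "parcs (relabel f G) `` {a} \<subseteq> f ` (parcs G `` {v})"
  proof
    fix b assume b: "b \<in> parcs (relabel f G) `` {a}"
    then obtain w where w: "w \<in> pverts G" "b = f w" using D(2) by auto
    then show "b \<in> f ` (parcs G `` {v})"
      using b v relabel_arc_iff[OF G inj v(1) w(1)] by (simp del: relabel_simps)
  qed
  moreover have fin: "finite (parcs G `` {v})" using D(1,2) by (auto intro: finite_subset)
  ultimately have "card (parcs (relabel f G) `` {a}) \<le> card (parcs G `` {v})"
    by (meson card_image_le card_mono finite_imageI le_trans)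
  also have "\<dots> \<le> max_degree G" by (rule card_neighbors_le_max_degree[OF D(1) v(1)])
  finally show "card (parcs (relabel f G) `` {a}) \<le> max_degree G" .
qed

lemma clique_number_relabel_le:
  assumes G: "pair_graph G" and inj: "inj_on f (pverts G)"
  shows "clique_number (relabel f G) \<le> clique_number G"
proof -
  note D = pair_graphD[OF G]
  obtain K where K: "clique (relabel f G) K" "card K = clique_number (relabel f G)"
    using ex_clique_card[of "relabel f G"] D(1) by auto
  let ?K = "pverts G \<inter> f -` K"
  have "(u, v) \<in> parcs G" if "u \<in> ?K" "v \<in> ?K" "u \<noteq> v" for u v
  proof -
    have "f u \<noteq> f v" using inj that by (auto dest: inj_onD)
    then have "(f u, f v) \<in> parcs (relabel f G)"
      using K(1) that by (auto simp: clique_def pairwise_def simp del: relabel_simps)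
    then show ?thesis using relabel_arc_iff[OF G inj] that by blast
  qed
  then have "clique G ?K" by (auto simp: clique_def pairwise_def)
  then have "card ?K \<le> clique_number G" by (rule card_clique_le[OF D(1)])
  moreover have "f ` ?K = K" using K(1) by (auto simp: clique_def)
  then have "card K = card ?K" using card_image[OF inj_on_subset[OF inj, of ?K]] by simp
  ultimately show ?thesis using K(2) by simp
qed

lemma chromatic_number_le_relabel:
  assumes G: "pair_graph G" and inj: "inj_on f (pverts G)"
  shows "chromatic_number G \<le> chromatic_number (relabel f G)"
proof -
  obtain c where "proper_coloring (relabel f G) (chromatic_number (relabel f G)) c"
    using ex_coloring_chromatic_number[OF pair_graph_relabel[OF G inj]] by blast
  then have "proper_coloring G (chromatic_number (relabel f G)) (c \<circ> f)"
    by (fastforce simp: proper_coloring_def)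
  then show ?thesis by (rule chromatic_number_le)
qed

definition copies :: "nat \<Rightarrow> 'a pair_pre_digraph \<Rightarrow> ('a \<times> nat) pair_pre_digraph" where
  "copies m G = \<lparr> pverts = pverts G \<times> {..<m},
     parcs = {((u, i), (v, j)). (u, v) \<in> parcs G \<and> i = j \<and> i < m} \<rparr>"

lemma copies_simps [simp]:
  "pverts (copies m G) = pverts G \<times> {..<m}"
  "((u, i), (v, j)) \<in> parcs (copies m G) \<longleftrightarrow> (u, v) \<in> parcs G \<and> i = j \<and> i < m"
  by (simp_all add: copies_def)

lemma pair_graph_copies:
  assumes "pair_graph G" shows "pair_graph (copies m G)"
  using pair_graphD[OF assms] by (intro pair_graphI) (auto simp: copies_def)

lemma vertex_transitive_copies:
  assumes G: "pair_graph G" and vt: "vertex_transitive G"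
  shows "vertex_transitive (copies m G)"
  unfolding vertex_transitive_iff_automorphism[OF pair_graph_copies[OF G]]
proof (intro ballI)
  fix a b assume "a \<in> pverts (copies m G)" "b \<in> pverts (copies m G)"
  then obtain u i v j where uv: "u \<in> pverts G" "v \<in> pverts G" "i < m" "j < m"
    "a = (u, i)" "b = (v, j)" by auto
  obtain h where h: "automorphism G h" "h u = v"
    using vt uv unfolding vertex_transitive_iff_automorphism[OF G] by blast
  let ?t = "transpose i j"
  have t: "bij_betw ?t {..<m} {..<m}"
    using uv by (intro bij_betw_byWitness[of _ ?t]) (auto simp: transpose_def)
  then have t_lt: "?t k < m" if "k < m" for k using that by (auto simp: bij_betw_def)
  have "bij_betw h (pverts G) (pverts G)" using h by (simp add: automorphism_def)
  then have "bij_betw (map_prod h ?t) (pverts (copies m G)) (pverts (copies m G))"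
    using t by (simp add: bij_betw_map_prod)
  then have "automorphism (copies m G) (map_prod h ?t)"
    using h(1) t_lt by (auto simp: automorphism_def inj_eq[OF inj_transpose])
  moreover have "map_prod h ?t a = b" using uv h(2) by simp
  ultimately show "\<exists>g. automorphism (copies m G) g \<and> g a = b" by blast
qed

lemma max_degree_copies_le:
  assumes G: "pair_graph G"
  shows "max_degree (copies m G) \<le> max_degree G"
proof (rule max_degree_leI)
  note D = pair_graphD[OF G]
  show "finite (pverts (copies m G))" using D(1) by simp
  fix a assume "a \<in> pverts (copies m G)"
  then obtain v i where v: "v \<in> pverts G" "i < m" "a = (v, i)" by auto
  have "parcs (copies m G) `` {a} = (parcs G `` {v}) \<times> {i}" using v by auto
  then show "card (parcs (copies m G) `` {a}) \<le> max_degree G"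
    using card_neighbors_le_max_degree[OF D(1) v(1)] by (simp add: card_cartesian_product)
qed

section \<open>Coloring systems of disjoint sets of equal size\<close>

text \<open>
  The variant of strong \<open>r\<close>-colorability in which the parts need not cover the vertices; only the
  covered vertices have to be colored. Unlike the version for partitions it makes sense
  for every \<open>r\<close> and is easily seen to be monotone in \<open>r\<close>.
\<close>

definition system_colorable :: "nat \<Rightarrow> 'a pair_pre_digraph \<Rightarrow> bool" where
  "system_colorable r G \<longleftrightarrow>
     (\<forall>F. disjoint F \<and> (\<forall>X\<in>F. X \<subseteq> pverts G \<and> card X = r) \<longrightarrow>
        (\<exists>c. (\<forall>X\<in>F. bij_betw c X {..<r}) \<and>
             (\<forall>(u, v)\<in>parcs G. u \<in> \<Union>F \<and> v \<in> \<Union>F \<longrightarrow> c u \<noteq> c v)))"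

lemma system_colorableD:
  assumes "system_colorable r G" "disjoint F" "\<forall>X\<in>F. X \<subseteq> pverts G \<and> card X = r"
  shows "\<exists>c. (\<forall>X\<in>F. bij_betw c X {..<r}) \<and>
    (\<forall>u v. (u, v) \<in> parcs G \<longrightarrow> u \<in> \<Union>F \<longrightarrow> v \<in> \<Union>F \<longrightarrow> c u \<noteq> c v)"
proof -
  have "\<exists>c. (\<forall>X\<in>F. bij_betw c X {..<r}) \<and>
             (\<forall>(u, v)\<in>parcs G. u \<in> \<Union>F \<and> v \<in> \<Union>F \<longrightarrow> c u \<noteq> c v)"
    using assms unfolding system_colorable_def by blast
  then show ?thesis by fast
qed

lemma ex_equipartition:
  assumes "finite A" "r > 0" "r dvd card A"
  shows "\<exists>P. partition_on A P \<and> (\<forall>X\<in>P. card X = r)"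
  using assms
proof (induction "card A" arbitrary: A rule: less_induct)
  case less
  show ?case
  proof (cases "A = {}")
    case True then show ?thesis by (intro exI[of _ "{}"]) (auto simp: partition_on_def)
  next
    case False
    then have "r \<le> card A" using less.prems by (simp add: dvd_imp_le card_gt_0_iff)
    then obtain X where X: "X \<subseteq> A" "card X = r" using obtain_subset_with_card_n by metis
    have fX: "finite X" using X(1) less.prems(1) by (rule finite_subset)
    have card: "card (A - X) = card A - r" using X fX by (simp add: card_Diff_subset)
    have "card (A - X) < card A" "r dvd card (A - X)"
      using card less.prems \<open>r \<le> card A\<close> by (simp_all add: dvd_diff_nat)
    then obtain P where P: "partition_on (A - X) P" "\<forall>Y\<in>P. card Y = r"
      using less.hyps[of "A - X"] less.prems by auto
    have "X \<noteq> {}" using X(2) less.prems(2) by auto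
    then have "partition_on A (insert X P)"
      using P(1) X(1) unfolding partition_on_def
      by (auto simp: disjoint_def)
    with P(2) X(2) show ?thesis by (intro exI[of _ "insert X P"]) auto
  qed
qed

text \<open>
  A system of disjoint \<open>r\<close>-sets leaves a number of vertices divisible by \<open>r\<close>, so it is part
  of a partition into \<open>r\<close>-sets.
\<close>

lemma strongly_colorable_imp_system_colorable:
  assumes fin: "finite (pverts G)" and r: "r > 0" "r dvd card (pverts G)"
    and strong: "strongly_colorable r G"
  shows "system_colorable r G"
  unfolding system_colorable_def
proof (intro allI impI, elim conjE)
  fix F assume disj: "disjoint F" and F: "\<forall>X\<in>F. X \<subseteq> pverts G \<and> card X = r"
  have sub: "\<Union>F \<subseteq> pverts G" using F by blast
  have finX: "finite X" if "X \<in> F" for X using F fin that by (meson finite_subset)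
  have "card (\<Union>F) = (\<Sum>X\<in>F. card X)" using card_Union_disjoint disj finX by blast
  then have "r dvd card (\<Union>F)" using F by simp
  moreover have "card (pverts G - \<Union>F) = card (pverts G) - card (\<Union>F)"
    using sub fin by (simp add: card_Diff_subset finite_subset)
  ultimately have "r dvd card (pverts G - \<Union>F)" using r(2) by (simp add: dvd_diff_nat)
  then obtain P where P: "partition_on (pverts G - \<Union>F) P" "\<forall>X\<in>P. card X = r"
    using ex_equipartition fin r(1) by (meson finite_Diff)
  have "{} \<notin> F" using F r(1) by force
  then have "partition_on (pverts G) (F \<union> P)"
    using P(1) disj sub unfolding partition_on_def by (auto intro!: disjoint_union)
  moreover have "\<forall>X\<in>F \<union> P. card X = r" using F P(2) by auto
  ultimately obtain c where c: "proper_coloring G r c" "\<forall>X\<in>F \<union> P. c ` X = {..<r}"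
    using strong r(2) unfolding strongly_colorable_def strongly_colorable_mult_def by auto
  have "bij_betw c X {..<r}" if "X \<in> F" for X
    using c(2) F finX that by (auto simp: bij_betw_def intro: eq_card_imp_inj_on)
  with c(1) show "\<exists>c. (\<forall>X\<in>F. bij_betw c X {..<r}) \<and>
             (\<forall>(u, v)\<in>parcs G. u \<in> \<Union>F \<and> v \<in> \<Union>F \<longrightarrow> c u \<noteq> c v)"
    by (intro exI[of _ c]) (auto simp: proper_coloring_def)
qed

text \<open>
  Fellows' argument. Drop one vertex from every set and color the rest; the vertices of
  color \<open>0\<close> form an independent set meeting every member of the system once. These
  vertices share the new color \<open>r\<close>, and what is left is again a system of \<open>r\<close>-sets.
\<close>

lemma system_colorable_Suc:
  assumes r: "r > 0" and col: "system_colorable r G"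
  shows "system_colorable (Suc r) G"
  unfolding system_colorable_def
proof (intro allI impI, elim conjE)
  fix F assume disj: "disjoint F" and F: "\<forall>X\<in>F. X \<subseteq> pverts G \<and> card X = Suc r"
  have shrink: "\<exists>c. (\<forall>X\<in>F. bij_betw c (X - {h X}) {..<r}) \<and>
      (\<forall>u v. (u, v) \<in> parcs G \<longrightarrow> u \<in> (\<Union>X\<in>F. X - {h X}) \<longrightarrow> v \<in> (\<Union>X\<in>F. X - {h X}) \<longrightarrow>
        c u \<noteq> c v)" if h: "\<forall>X\<in>F. h X \<in> X" for h
  proof -
    let ?F = "(\<lambda>X. X - {h X}) ` F"
    have disj': "disjoint ?F"
    proof (rule disjointI)
      fix A B assume "A \<in> ?F" "B \<in> ?F" "A \<noteq> B"
      then obtain X Y where XY: "X \<in> F" "Y \<in> F" "A = X - {h X}" "B = Y - {h Y}" "X \<noteq> Y" by auto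
      then have "X \<inter> Y = {}" using disj by (simp add: disjoint_def)
      then show "A \<inter> B = {}" using XY by blast
    qed
    have "\<forall>X\<in>?F. X \<subseteq> pverts G \<and> card X = r" using F h by auto
    from system_colorableD[OF col disj' this] show ?thesis by simp
  qed
  have "\<exists>x. x \<in> X" if "X \<in> F" for X
    using F that by (metis card.empty ex_in_conv nat.distinct(1))
  then obtain h where h: "\<forall>X\<in>F. h X \<in> X" by metis
  from shrink[OF h] obtain c where c: "\<forall>X\<in>F. bij_betw c (X - {h X}) {..<r}"
    and c_arc: "\<And>u v. (u, v) \<in> parcs G \<Longrightarrow> u \<in> (\<Union>X\<in>F. X - {h X}) \<Longrightarrow>
        v \<in> (\<Union>X\<in>F. X - {h X}) \<Longrightarrow> c u \<noteq> c v" by blast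
  have "\<exists>x\<in>X - {h X}. c x = 0" if "X \<in> F" for X
  proof -
    have "0 \<in> c ` (X - {h X})" using c that r by (simp add: bij_betw_def)
    then show ?thesis by force
  qed
  then obtain t where t: "\<forall>X\<in>F. t X \<in> X - {h X} \<and> c (t X) = 0" by metis
  then have t_in: "\<forall>X\<in>F. t X \<in> X" by blast
  from shrink[OF t_in] obtain d where d: "\<forall>X\<in>F. bij_betw d (X - {t X}) {..<r}"
    and d_arc: "\<And>u v. (u, v) \<in> parcs G \<Longrightarrow> u \<in> (\<Union>X\<in>F. X - {t X}) \<Longrightarrow>
        v \<in> (\<Union>X\<in>F. X - {t X}) \<Longrightarrow> d u \<noteq> d v" by blast
  have t_unique: "v = t X" if v: "X \<in> F" "v \<in> X" "v \<in> t ` F" for X v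
  proof -
    obtain Y where Y: "Y \<in> F" "v = t Y" using v(3) by blast
    then have "X \<inter> Y \<noteq> {}" using t_in v(2) by blast
    then have "X = Y" using disj v(1) Y(1) unfolding disjoint_def by blast
    then show ?thesis using Y(2) by simp
  qed
  define e where "e v = (if v \<in> t ` F then r else d v)" for v
  have d_lt: "d v < r" if "v \<in> \<Union>F" "v \<notin> t ` F" for v
  proof -
    obtain X where X: "X \<in> F" "v \<in> X" using \<open>v \<in> \<Union>F\<close> by blast
    then have "v \<in> X - {t X}" using that(2) by auto
    then show ?thesis using d X(1) by (auto simp: bij_betw_def)
  qed
  have "bij_betw e X {..<Suc r}" if X: "X \<in> F" for X
  proof -
    have "e v = d v" if "v \<in> X - {t X}" for v using that t_unique[OF X] by (auto simp: e_def)
    then have "bij_betw e (X - {t X}) {..<r}"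
      using d X bij_betw_cong[of "X - {t X}" e d] by blast
    moreover have "e (t X) = r" using X by (simp add: e_def)
    ultimately have "bij_betw e (insert (t X) (X - {t X})) (insert r {..<r})"
      using notIn_Un_bij_betw[of "t X" "X - {t X}" e "{..<r}"] by simp
    moreover have "insert (t X) (X - {t X}) = X" using t_in X by blast
    ultimately show ?thesis by (simp add: lessThan_Suc)
  qed
  moreover have "e u \<noteq> e v" if arc: "(u, v) \<in> parcs G" and u: "u \<in> \<Union>F" and v: "v \<in> \<Union>F" for u v
  proof (cases "u \<in> t ` F"; cases "v \<in> t ` F")
    assume "u \<in> t ` F" "v \<in> t ` F"
    then have "c u = 0" "c v = 0" "u \<in> (\<Union>X\<in>F. X - {h X})" "v \<in> (\<Union>X\<in>F. X - {h X})"
      using t by auto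
    then show ?thesis using c_arc[OF arc] by simp
  next
    assume "u \<notin> t ` F" "v \<notin> t ` F"
    then have "u \<in> (\<Union>X\<in>F. X - {t X})" "v \<in> (\<Union>X\<in>F. X - {t X})" using u v by auto
    then show ?thesis using d_arc[OF arc] \<open>u \<notin> t ` F\<close> \<open>v \<notin> t ` F\<close> by (simp add: e_def)
  qed (use d_lt[OF u] d_lt[OF v] in \<open>auto simp: e_def\<close>)
  ultimately show "\<exists>c. (\<forall>X\<in>F. bij_betw c X {..<Suc r}) \<and>
             (\<forall>(u, v)\<in>parcs G. u \<in> \<Union>F \<and> v \<in> \<Union>F \<longrightarrow> c u \<noteq> c v)"
    by (intro exI[of _ e]) auto
qed

lemma system_colorable_mono:
  assumes "system_colorable r G" "0 < r" "r \<le> r'"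
  shows "system_colorable r' G"
  using assms(3,1,2) by (induction rule: dec_induct) (auto intro: system_colorable_Suc)

lemma system_colorable_of_relabel:
  assumes inj: "inj_on f (pverts G)" and G: "pair_graph G"
    and col: "system_colorable r (relabel f G)"
  shows "system_colorable r G"
  unfolding system_colorable_def
proof (intro allI impI, elim conjE)
  fix F assume disj: "disjoint F" and F: "\<forall>X\<in>F. X \<subseteq> pverts G \<and> card X = r"
  let ?F = "(`) f ` F"
  have disj': "disjoint ?F"
  proof (rule disjointI)
    fix A B assume "A \<in> ?F" "B \<in> ?F" "A \<noteq> B"
    then obtain X Y where XY: "X \<in> F" "Y \<in> F" "A = f ` X" "B = f ` Y" "X \<noteq> Y" by auto
    then have "X \<inter> Y = {}" using disj by (simp add: disjoint_def)
    then show "A \<inter> B = {}"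
      using XY F inj_on_image_Int[OF inj, of X Y] by simp
  qed
  have "card (f ` X) = r" if "X \<in> F" for X
    using that F inj by (auto simp: card_image inj_on_subset)
  then have "\<forall>A\<in>?F. A \<subseteq> pverts (relabel f G) \<and> card A = r" using F by auto
  from system_colorableD[OF col disj' this]
  obtain c where c: "\<forall>A\<in>?F. bij_betw c A {..<r}"
    and arc: "\<forall>a b. (a, b) \<in> parcs (relabel f G) \<longrightarrow> a \<in> \<Union>?F \<longrightarrow> b \<in> \<Union>?F \<longrightarrow> c a \<noteq> c b"
    by (elim exE conjE)
  have "bij_betw (c \<circ> f) X {..<r}" if X: "X \<in> F" for X
  proof (rule bij_betw_trans)
    show "bij_betw f X (f ` X)" using inj_on_subset[OF inj] F X by (simp add: bij_betw_def)
    show "bij_betw c (f ` X) {..<r}" using c X by blast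
  qed
  moreover have "(c \<circ> f) u \<noteq> (c \<circ> f) v"
    if "(u, v) \<in> parcs G" "u \<in> \<Union>F" "v \<in> \<Union>F" for u v
  proof -
    have "(f u, f v) \<in> parcs (relabel f G)" using that(1) by force
    moreover have "f u \<in> \<Union>?F" "f v \<in> \<Union>?F" using that(2,3) by blast+
    ultimately show ?thesis using arc unfolding o_apply by blast
  qed
  ultimately show "\<exists>c. (\<forall>X\<in>F. bij_betw c X {..<r}) \<and>
             (\<forall>(u, v)\<in>parcs G. u \<in> \<Union>F \<and> v \<in> \<Union>F \<longrightarrow> c u \<noteq> c v)"
    by (intro exI[of _ "c \<circ> f"]) auto
qed

text \<open>
  The number of copies is a multiple of \<open>b!\<close> for the common bound \<open>b\<close> on the strong chromatic
  numbers of all graphs \<open>copies m H\<close>. So whatever the strong chromatic number \<open>s\<close> is for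
  the chosen \<open>m\<close>, it divides the number of vertices. In the edgeless case no bound
  is available, but \<open>s = 1\<close> works.
\<close>

lemma ex_system_colorable_copies:
  assumes strong: "\<And>H :: nat pair_pre_digraph.
      pair_graph H \<Longrightarrow> vertex_transitive H \<Longrightarrow> parcs H \<noteq> {} \<Longrightarrow>
      real (strong_chromatic_number H) \<le> 5 / 2 * real (max_degree H)"
    and H: "pair_graph H" "vertex_transitive H"
  shows "\<exists>m s. M < m \<and> 0 < s \<and> (s = 1 \<or> 2 * s \<le> 5 * max_degree H) \<and>
    system_colorable s (copies m H)"
proof (cases "parcs H = {}")
  case True
  then have "parcs (copies (Suc M) H) = {}" by (simp add: copies_def)
  moreover have "bij_betw (\<lambda>_. 0) X {..<1::nat}" if "card X = 1" for X :: "('a \<times> nat) set"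
    using that by (auto simp: card_1_singleton_iff bij_betw_def)
  ultimately have "system_colorable 1 (copies (Suc M) H)"
    unfolding system_colorable_def by (intro allI impI exI[of _ "\<lambda>_. 0"]) auto
  then show ?thesis by (intro exI[of _ "Suc M"] exI[of _ 1]) auto
next
  case False
  define b where "b = 5 * max_degree H"
  define m where "m = Suc M * fact b"
  let ?C = "copies m H"
  have "Suc M * 1 \<le> m" unfolding m_def by (intro mult_le_mono) auto
  then have m: "M < m" by simp
  note C = pair_graph_copies[OF H(1), of m] and finC = pair_graphD(1)[OF pair_graph_copies[OF H(1)]]
  obtain f :: "_ \<Rightarrow> nat" where inj: "inj_on f (pverts ?C)"
    using finite_imp_inj_to_nat_seg[OF finC] by blast
  let ?N = "relabel f ?C"
  have N: "pair_graph ?N" by (rule pair_graph_relabel[OF C inj])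
  have vtN: "vertex_transitive ?N"
    by (rule vertex_transitive_relabel[OF C inj vertex_transitive_copies[OF H]])
  obtain u v where uv: "(u, v) \<in> parcs H" using False by auto
  then have "((u, 0), (v, 0)) \<in> parcs ?C" using m by simp
  then have "parcs ?C \<noteq> {}" by blast
  then have ne: "parcs ?N \<noteq> {}" by simp
  then have "pverts ?N \<noteq> {}" using pair_graphD(2)[OF N] by blast
  then have "card (pverts ?N) > 0" using pair_graphD(1)[OF N] by (simp add: card_gt_0_iff)
  define s where "s = strong_chromatic_number ?N"
  have "s > 0 \<and> strongly_colorable s ?N"
    unfolding s_def strong_chromatic_number_def
    by (rule LeastI[of _ "card (pverts ?N)"])
      (use \<open>card (pverts ?N) > 0\<close> strongly_colorable_card[OF N] in blast)
  then have s: "s > 0" "strongly_colorable s ?N" by auto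
  have "max_degree ?N \<le> max_degree H"
    using max_degree_relabel_le[OF C inj] max_degree_copies_le[OF H(1), of m] by linarith
  moreover have "real s \<le> 5 / 2 * real (max_degree ?N)"
    unfolding s_def by (rule strong[OF N vtN ne])
  ultimately have "2 * real s \<le> 5 * real (max_degree H)" by linarith
  then have s_le: "2 * s \<le> 5 * max_degree H" by linarith
  then have "s dvd fact b" using s(1) by (intro dvd_fact) (auto simp: b_def)
  moreover have "card (pverts ?N) = card (pverts H) * m"
    using card_image[OF inj] by (simp add: card_cartesian_product)
  ultimately have "s dvd card (pverts ?N)" by (simp add: m_def)
  then have "system_colorable s ?N"
    by (rule strongly_colorable_imp_system_colorable[OF pair_graphD(1)[OF N] s(1) _ s(2)])
  then have "system_colorable s ?C" by (rule system_colorable_of_relabel[OF inj C])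
  with m s(1) s_le show ?thesis by blast
qed

section \<open>Maximum cliques in vertex-transitive graphs\<close>

definition max_clique :: "'a pair_pre_digraph \<Rightarrow> 'a set \<Rightarrow> bool" where
  "max_clique G K \<longleftrightarrow> clique G K \<and> card K = clique_number G"

lemma max_clique_subset: "max_clique G K \<Longrightarrow> K \<subseteq> pverts G"
  by (simp add: max_clique_def clique_def)

lemma max_clique_arc: "max_clique G K \<Longrightarrow> u \<in> K \<Longrightarrow> v \<in> K \<Longrightarrow> u \<noteq> v \<Longrightarrow> (u, v) \<in> parcs G"
  by (auto simp: max_clique_def clique_def pairwise_def)

lemma max_clique_image:
  assumes "automorphism G f" "max_clique G K"
  shows "max_clique G (f ` K)"
proof -
  have f: "bij_betw f (pverts G) (pverts G)" using assms(1) by (simp add: automorphism_def)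
  have K: "K \<subseteq> pverts G" by (rule max_clique_subset[OF assms(2)])
  have "card (f ` K) = card K"
    using f K by (meson bij_betw_def card_image inj_on_subset)
  moreover have "(f u, f v) \<in> parcs G" if uv: "u \<in> K" "v \<in> K" "f u \<noteq> f v" for u v
  proof -
    have "(u, v) \<in> parcs G" using max_clique_arc[OF assms(2)] uv by blast
    then show ?thesis using assms(1) uv K unfolding automorphism_def by blast
  qed
  then have "pairwise (\<lambda>a b. (a, b) \<in> parcs G) (f ` K)"
    by (auto simp: pairwise_def)
  moreover have "f ` K \<subseteq> pverts G" using f K by (auto simp: bij_betw_def)
  ultimately show ?thesis using assms(2) by (simp add: max_clique_def clique_def)
qed

lemma ex_max_clique_at:
  assumes G: "pair_graph G" and vt: "vertex_transitive G" and v: "v \<in> pverts G"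
  shows "\<exists>K. max_clique G K \<and> v \<in> K"
proof -
  obtain K where K: "max_clique G K"
    using ex_clique_card[OF pair_graphD(1)[OF G]] by (auto simp: max_clique_def)
  have "clique G {v}" using v by (simp add: clique_def)
  then have "1 \<le> clique_number G" using card_clique_le[OF pair_graphD(1)[OF G]] by fastforce
  then have "K \<noteq> {}" using K by (auto simp: max_clique_def)
  then obtain u where u: "u \<in> K" by blast
  then obtain f where "automorphism G f" "f u = v"
    using vt v max_clique_subset[OF K] unfolding vertex_transitive_iff_automorphism[OF G] by blast
  then show ?thesis using max_clique_image[OF _ K] u by blast
qed

text \<open>
  Hajnal's inequality. When \<open>K\<close> joins the family \<open>F\<close>, the set \<open>(K \<inter> \<Union>F) \<union> \<Inter>F\<close> is a clique,
  since a vertex of \<open>\<Inter>F\<close> lies in a common clique with every vertex of \<open>\<Union>F\<close>. Its size is at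
  most \<open>\<omega>\<close>, which says that the intersection loses no more vertices than the union gains.
\<close>

lemma hajnal:
  assumes fin: "finite (pverts G)"
    and "finite F" "F \<noteq> {}" "\<And>K. K \<in> F \<Longrightarrow> max_clique G K"
  shows "2 * clique_number G \<le> card (\<Inter>F) + card (\<Union>F)"
  using assms(2-4)
proof (induction F rule: finite_ne_induct)
  case (singleton K)
  then show ?case by (simp add: max_clique_def)
next
  case (insert K F)
  let ?I = "\<Inter>F" and ?U = "\<Union>F"
  have K: "max_clique G K" and F: "\<And>L. L \<in> F \<Longrightarrow> max_clique G L" using insert.prems by auto
  have subK: "K \<subseteq> pverts G" and subU: "?U \<subseteq> pverts G"
    using K F max_clique_subset by blast+
  have IU: "?I \<subseteq> ?U" using insert.hyps(2) by blast
  have fins: "finite K" "finite ?U" "finite ?I"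
    using subK subU IU fin by (meson finite_subset subset_trans)+
  have "(u, v) \<in> parcs G" if uv: "u \<in> K \<inter> ?U \<union> ?I" "v \<in> K \<inter> ?U \<union> ?I" "u \<noteq> v" for u v
  proof -
    have "(u \<in> K \<and> v \<in> K) \<or> (\<exists>L\<in>F. u \<in> L \<and> v \<in> L)" using uv insert.hyps(2) by blast
    then show ?thesis using uv(3) K F max_clique_arc by metis
  qed
  then have "clique G (K \<inter> ?U \<union> ?I)"
    using subK subU IU by (auto simp: clique_def pairwise_def)
  then have "card (K \<inter> ?U \<union> ?I) \<le> clique_number G" by (rule card_clique_le[OF fin])
  moreover have "card (K \<inter> ?U) + card ?I = card (K \<inter> ?U \<union> ?I) + card (K \<inter> ?I)"
  proof -
    have "K \<inter> ?U \<inter> ?I = K \<inter> ?I" using IU by blast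
    then show ?thesis using card_Un_Int[of "K \<inter> ?U" ?I] fins by simp
  qed
  moreover have "card K + card ?U = card (K \<union> ?U) + card (K \<inter> ?U)"
    using card_Un_Int[of K ?U] fins by simp
  moreover have "card K = clique_number G" using K by (simp add: max_clique_def)
  moreover have "2 * clique_number G \<le> card ?I + card ?U" using insert.IH F by blast
  ultimately show ?case by simp
qed

text \<open>
  By Hajnal's inequality the intersection of all maximum cliques through a vertex \<open>v\<close> (its core)
  has at least \<open>2\<omega> - (\<Delta> + 1) > \<omega> / 2\<close> vertices. So the cores of two vertices of one maximum clique
  share a vertex \<open>z\<close>, and counting identifies the families of both vertices with that of \<open>z\<close>.
\<close>

lemma max_cliques_disjoint:
  assumes G: "pair_graph G" and vt: "vertex_transitive G"
    and large: "2 * (max_degree G + 1) < 3 * clique_number G"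
    and A: "max_clique G A" "x \<in> A" and B: "max_clique G B" "x \<in> B"
  shows "A = B"
proof -
  let ?\<omega> = "clique_number G" and ?F = "\<lambda>x. {K. max_clique G K \<and> x \<in> K}"
  have fin: "finite (pverts G)" by (rule pair_graphD(1)[OF G])
  have finF: "finite (?F v)" for v
    by (rule finite_subset[OF _ finite_cliques[OF fin]]) (auto simp: max_clique_def)
  have card_le: "card (?F u) \<le> card (?F v)" if uv: "u \<in> pverts G" "v \<in> pverts G" for u v
  proof -
    obtain f where f: "automorphism G f" "f u = v"
      using vt uv unfolding vertex_transitive_iff_automorphism[OF G] by blast
    then have "inj_on f (pverts G)" by (simp add: automorphism_def bij_betw_def)
    then have "inj_on ((`) f) (?F u)"
      by (rule inj_on_subset[OF inj_on_image_Pow]) (auto dest: max_clique_subset)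
    moreover have "(`) f ` ?F u \<subseteq> ?F v" using f max_clique_image by blast
    ultimately show ?thesis using finF by (rule card_inj_on_le)
  qed
  have core: "2 * ?\<omega> \<le> card (\<Inter>(?F v)) + (max_degree G + 1)" if K: "max_clique G K" "v \<in> K" for v K
  proof -
    have v: "v \<in> pverts G" using K max_clique_subset by blast
    have fN: "finite (parcs G `` {v})"
      using pair_graphD(2)[OF G] fin by (auto intro: finite_subset)
    have "u \<in> insert v (parcs G `` {v})" if "max_clique G L" "v \<in> L" "u \<in> L" for L u
      using max_clique_arc[OF that] by blast
    then have "\<Union>(?F v) \<subseteq> insert v (parcs G `` {v})" by blast
    then have "card (\<Union>(?F v)) \<le> card (insert v (parcs G `` {v}))"
      using fN by (intro card_mono) auto
    also have "\<dots> \<le> card (parcs G `` {v}) + 1" using fN by (simp add: card_insert_if)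
    also have "\<dots> \<le> max_degree G + 1" using card_neighbors_le_max_degree[OF fin v] by simp
    finally have "card (\<Union>(?F v)) \<le> max_degree G + 1" .
    moreover have "2 * ?\<omega> \<le> card (\<Inter>(?F v)) + card (\<Union>(?F v))"
      by (rule hajnal[OF fin finF]) (use K in auto)
    ultimately show ?thesis by linarith
  qed
  have same: "?F x = ?F y" if K: "max_clique G K" "x \<in> K" "y \<in> K" for x y K
  proof -
    let ?X = "\<Inter>(?F x)" and ?Y = "\<Inter>(?F y)"
    have sub: "?X \<subseteq> K" "?Y \<subseteq> K" using K by blast+
    have fK: "finite K" using K(1) max_clique_subset fin finite_subset by blast
    have "?X \<inter> ?Y \<noteq> {}"
    proof
      assume "?X \<inter> ?Y = {}"
      then have "card (?X \<union> ?Y) = card ?X + card ?Y"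
        using sub fK by (intro card_Un_disjoint) (auto intro: finite_subset)
      moreover have "card (?X \<union> ?Y) \<le> card K" using sub fK by (intro card_mono) auto
      moreover have "card K = ?\<omega>" using K(1) by (simp add: max_clique_def)
      ultimately show False using core[OF K(1,2)] core[OF K(1,3)] large by simp
    qed
    then obtain z where z: "z \<in> ?X" "z \<in> ?Y" by blast
    have verts: "x \<in> pverts G" "y \<in> pverts G" "z \<in> pverts G"
      using K z sub max_clique_subset by blast+
    have "?F x = ?F z"
      by (rule card_seteq[OF finF]) (use z card_le verts in auto)
    moreover have "?F y = ?F z"
      by (rule card_seteq[OF finF]) (use z card_le verts in auto)
    ultimately show ?thesis by simp
  qed
  have "A \<subseteq> B" using same[OF A(1) A(2)] B by blast
  moreover have "B \<subseteq> A" using same[OF B(1) B(2)] A by blast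
  ultimately show ?thesis by blast
qed

section \<open>The graph of edges outside the maximum cliques\<close>

definition remove_max_cliques :: "'a pair_pre_digraph \<Rightarrow> 'a pair_pre_digraph" where
  "remove_max_cliques G = \<lparr> pverts = pverts G,
     parcs = {(u, v) \<in> parcs G. \<nexists>K. max_clique G K \<and> u \<in> K \<and> v \<in> K} \<rparr>"

lemma remove_max_cliques_simps [simp]:
  "pverts (remove_max_cliques G) = pverts G"
  "(u, v) \<in> parcs (remove_max_cliques G) \<longleftrightarrow>
     (u, v) \<in> parcs G \<and> (\<nexists>K. max_clique G K \<and> u \<in> K \<and> v \<in> K)"
  by (simp_all add: remove_max_cliques_def)

lemma pair_graph_remove_max_cliques:
  assumes "pair_graph G" shows "pair_graph (remove_max_cliques G)"
  using pair_graphD[OF assms] by (intro pair_graphI) (auto simp: remove_max_cliques_def)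

lemma vertex_transitive_remove_max_cliques:
  assumes G: "pair_graph G" and vt: "vertex_transitive G"
  shows "vertex_transitive (remove_max_cliques G)"
proof -
  have "automorphism (remove_max_cliques G) f" if f: "automorphism G f" for f
  proof -
    let ?g = "inv_into (pverts G) f"
    have inj: "inj_on f (pverts G)" using f by (simp add: automorphism_def bij_betw_def)
    have "(\<exists>K. max_clique G K \<and> f u \<in> K \<and> f v \<in> K) \<longleftrightarrow> (\<exists>K. max_clique G K \<and> u \<in> K \<and> v \<in> K)"
      if uv: "u \<in> pverts G" "v \<in> pverts G" for u v
    proof
      assume "\<exists>K. max_clique G K \<and> f u \<in> K \<and> f v \<in> K"
      then obtain K where K: "max_clique G K" "f u \<in> K" "f v \<in> K" by blast
      then have "?g (f u) \<in> ?g ` K" "?g (f v) \<in> ?g ` K" by blast+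
      then have "u \<in> ?g ` K" "v \<in> ?g ` K" using uv inj by simp_all
      then show "\<exists>K. max_clique G K \<and> u \<in> K \<and> v \<in> K"
        using max_clique_image[OF automorphism_inv_into[OF f] K(1)] by blast
    next
      assume "\<exists>K. max_clique G K \<and> u \<in> K \<and> v \<in> K"
      then show "\<exists>K. max_clique G K \<and> f u \<in> K \<and> f v \<in> K"
        using max_clique_image[OF f] by blast
    qed
    then show ?thesis using f by (simp add: automorphism_def)
  qed
  then show ?thesis
    using vt unfolding vertex_transitive_iff_automorphism[OF G]
      vertex_transitive_iff_automorphism[OF pair_graph_remove_max_cliques[OF G]]
    by (metis remove_max_cliques_simps(1))
qed

lemma max_degree_remove_max_cliques:
  assumes G: "pair_graph G" and vt: "vertex_transitive G"
  shows "max_degree (remove_max_cliques G) \<le> max_degree G + 1 - clique_number G"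
proof (rule max_degree_leI)
  let ?H = "remove_max_cliques G"
  note D = pair_graphD[OF G]
  show "finite (pverts ?H)" using D(1) by simp
  fix v assume "v \<in> pverts ?H"
  then have v: "v \<in> pverts G" by simp
  obtain K where K: "max_clique G K" "v \<in> K" using ex_max_clique_at[OF G vt v] by blast
  have fK: "finite K" using K(1) max_clique_subset D(1) finite_subset by blast
  have fN: "finite (parcs G `` {v})" using D(1,2) by (auto intro: finite_subset)
  have sub: "parcs ?H `` {v} \<union> (K - {v}) \<subseteq> parcs G `` {v}"
    using max_clique_arc[OF K(1,2)] by auto
  have "card (parcs ?H `` {v}) + card (K - {v}) = card (parcs ?H `` {v} \<union> (K - {v}))"
    by (rule card_Un_disjoint[symmetric]) (use K sub fK fN in \<open>auto intro: finite_subset\<close>)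
  also have "\<dots> \<le> card (parcs G `` {v})" by (rule card_mono[OF fN sub])
  also have "\<dots> \<le> max_degree G" by (rule card_neighbors_le_max_degree[OF D(1) v])
  finally have "card (parcs ?H `` {v}) + (clique_number G - 1) \<le> max_degree G"
    using K fK by (simp add: max_clique_def)
  then show "card (parcs ?H `` {v}) \<le> max_degree G + 1 - clique_number G" by linarith
qed

section \<open>The bound on the chromatic number\<close>

text \<open>
  The clique \<open>K\<close> sits in copy \<open>0\<close> as \<open>K \<times> {0}\<close>; it is padded inside \<open>K \<times> {..<m}\<close>, so the padded
  sets inherit disjointness from the cliques. Restricting the coloring to copy \<open>0\<close> gives a
  coloring of \<open>G\<close>: edges inside cliques are handled by injectivity, the others are edges of the
  colored graph.
\<close>

lemma chromatic_number_le_of_disjoint_max_cliques: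
  assumes G: "pair_graph G" and vt: "vertex_transitive G"
    and disj: "\<And>A B x. max_clique G A \<Longrightarrow> max_clique G B \<Longrightarrow> x \<in> A \<Longrightarrow> x \<in> B \<Longrightarrow> A = B"
    and col: "system_colorable t (copies m (remove_max_cliques G))"
    and t: "clique_number G \<le> t" "t < m"
  shows "chromatic_number G \<le> t"
proof (cases "pverts G = {}")
  case True
  then have "parcs G = {}" using pair_graphD(2)[OF G] by auto
  with True have "proper_coloring G t (\<lambda>_. 0)" by (simp add: proper_coloring_def)
  then show ?thesis by (rule chromatic_number_le)
next
  case False
  let ?H = "remove_max_cliques G"
  have "clique_number G > 0"
  proof -
    obtain v where "v \<in> pverts G" using False by blast
    then obtain K where K: "max_clique G K" "v \<in> K" using ex_max_clique_at[OF G vt] by blast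
    then have "finite K" using max_clique_subset pair_graphD(1)[OF G] finite_subset by blast
    then have "card K > 0" using K(2) by (auto simp: card_gt_0_iff)
    then show ?thesis using K(1) by (simp add: max_clique_def)
  qed
  have "\<exists>X. K \<times> {0} \<subseteq> X \<and> X \<subseteq> K \<times> {..<m} \<and> card X = t" if K: "max_clique G K" for K
  proof -
    have fK: "finite K" using K max_clique_subset pair_graphD(1)[OF G] finite_subset by blast
    have cK: "card K = clique_number G" using K by (simp add: max_clique_def)
    have "1 * m \<le> card K * m" using cK \<open>clique_number G > 0\<close> by (intro mult_le_mono) auto
    then have "t \<le> card K * m" using t(2) by linarith
    then have "t \<le> card (K \<times> {..<m})" by (simp add: card_cartesian_product)
    moreover have "card (K \<times> {0::nat}) \<le> t" using cK t(1) by (simp add: card_cartesian_product)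
    moreover have "K \<times> {0::nat} \<subseteq> K \<times> {..<m}" using t by auto
    ultimately show ?thesis using exists_subset_between[of "K \<times> {0}" t "K \<times> {..<m}"] fK by auto
  qed
  then obtain X where X: "K \<times> {0} \<subseteq> X K" "X K \<subseteq> K \<times> {..<m}" "card (X K) = t"
    if "max_clique G K" for K
    by metis
  let ?F = "X ` {K. max_clique G K}"
  have disj': "disjoint ?F"
  proof (rule disjointI)
    fix P Q assume "P \<in> ?F" "Q \<in> ?F" "P \<noteq> Q"
    then obtain K L where KL: "max_clique G K" "max_clique G L" "P = X K" "Q = X L" "K \<noteq> L" by auto
    have "K \<inter> L = {}" using disj[OF KL(1,2)] KL(5) by blast
    then show "P \<inter> Q = {}" using X(2)[OF KL(1)] X(2)[OF KL(2)] KL(3,4) by blast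
  qed
  have "X K \<subseteq> pverts (copies m ?H) \<and> card (X K) = t" if K: "max_clique G K" for K
    using X(2,3)[OF K] max_clique_subset[OF K] by auto
  then have "\<forall>P\<in>?F. P \<subseteq> pverts (copies m ?H) \<and> card P = t" by blast
  from system_colorableD[OF col disj' this]
  obtain c where c: "\<forall>P\<in>?F. bij_betw c P {..<t}"
    and arc: "\<forall>a b. (a, b) \<in> parcs (copies m ?H) \<longrightarrow> a \<in> \<Union>?F \<longrightarrow> b \<in> \<Union>?F \<longrightarrow> c a \<noteq> c b"
    by (elim exE conjE)
  have cover: "\<exists>K. max_clique G K \<and> (v, 0) \<in> X K" if "v \<in> pverts G" for v
    using ex_max_clique_at[OF G vt that] X(1) by blast
  have "proper_coloring G t (\<lambda>v. c (v, 0))"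
    unfolding proper_coloring_def
  proof (intro conjI)
    show "(\<lambda>v. c (v, 0)) ` pverts G \<subseteq> {..<t}"
    proof (rule image_subsetI)
      fix v assume "v \<in> pverts G"
      then obtain K where K: "max_clique G K" "(v, 0) \<in> X K" using cover by blast
      then have "bij_betw c (X K) {..<t}" using c by blast
      then show "c (v, 0) \<in> {..<t}" using K(2) bij_betwE by blast
    qed
    have "c (u, 0) \<noteq> c (v, 0)" if uv: "(u, v) \<in> parcs G" for u v
    proof (cases "\<exists>K. max_clique G K \<and> u \<in> K \<and> v \<in> K")
      case True
      then obtain K where K: "max_clique G K" "u \<in> K" "v \<in> K" by blast
      then have in_X: "(u, 0) \<in> X K" "(v, 0) \<in> X K" using X(1)[OF K(1)] by blast+
      have "inj_on c (X K)" using c K(1) by (auto simp: bij_betw_def)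
      then show ?thesis using in_X pair_graphD(3)[OF G uv] by (auto dest: inj_onD)
    next
      case False
      then have "((u, 0), (v, 0)) \<in> parcs (copies m ?H)" using uv t by simp
      moreover have "u \<in> pverts G" "v \<in> pverts G" using uv pair_graphD(2)[OF G] by auto
      then have "(u, 0) \<in> \<Union>?F" "(v, 0) \<in> \<Union>?F" using cover by blast+
      ultimately show ?thesis using arc by blast
    qed
    then show "\<forall>(u, v)\<in>parcs G. c (u, 0) \<noteq> c (v, 0)" by blast
  qed
  then show ?thesis by (rule chromatic_number_le)
qed

theorem theorem4p3:
  fixes G :: "'a pair_pre_digraph"
  assumes strong: "\<And>H :: nat pair_pre_digraph.
      pair_graph H \<Longrightarrow> vertex_transitive H \<Longrightarrow> parcs H \<noteq> {} \<Longrightarrow>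
      real (strong_chromatic_number H) \<le> 5 / 2 * real (max_degree H)"
    and reed: "\<And>H :: nat pair_pre_digraph.
      pair_graph H \<Longrightarrow> vertex_transitive H \<Longrightarrow>
      int (chromatic_number H) \<le> \<lceil>(real (clique_number H) + real (max_degree H) + 1) / 2\<rceil>"
    and "pair_graph G" and "vertex_transitive G"
  shows "int (chromatic_number G) \<le>
      max (int (clique_number G)) \<lceil>(5 * real (max_degree G) + 3) / 6\<rceil>"
proof -
  note D = pair_graphD[OF assms(3)]
  let ?\<chi> = "chromatic_number G" and ?\<omega> = "clique_number G" and ?\<Delta> = "max_degree G"
  \<comment> \<open>The integral form of the bound: \<open>\<lceil>(5\<Delta> + 3) / 6\<rceil>\<close> is \<open>(5\<Delta> + 8) div 6\<close>.\<close>
  have "?\<chi> \<le> ?\<omega> \<or> 6 * ?\<chi> \<le> 5 * ?\<Delta> + 8"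
  proof (cases "2 * (?\<Delta> + 1) < 3 * ?\<omega>")
    case False
    obtain f :: "'a \<Rightarrow> nat" where inj: "inj_on f (pverts G)"
      using finite_imp_inj_to_nat_seg[OF D(1)] by blast
    let ?N = "relabel f G"
    have "?\<chi> \<le> chromatic_number ?N" by (rule chromatic_number_le_relabel[OF assms(3) inj])
    moreover have "int (chromatic_number ?N)
        \<le> \<lceil>(real (clique_number ?N) + real (max_degree ?N) + 1) / 2\<rceil>"
      by (rule reed[OF pair_graph_relabel[OF assms(3) inj]
            vertex_transitive_relabel[OF assms(3) inj assms(4)]])
    then have "real (chromatic_number ?N) - 1
        < (real (clique_number ?N) + real (max_degree ?N) + 1) / 2"
      by (simp add: le_ceiling_iff)
    ultimately have "2 * real ?\<chi> < real (clique_number ?N) + real (max_degree ?N) + 3"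
      by (simp add: field_simps)
    then have "2 * ?\<chi> < clique_number ?N + max_degree ?N + 3" by linarith
    moreover have "clique_number ?N \<le> ?\<omega>" "max_degree ?N \<le> ?\<Delta>"
      by (rule clique_number_relabel_le[OF assms(3) inj], rule max_degree_relabel_le[OF assms(3) inj])
    ultimately have "2 * ?\<chi> \<le> ?\<omega> + ?\<Delta> + 2" by linarith
    moreover have "3 * ?\<omega> \<le> 2 * ?\<Delta> + 2" using False by simp
    ultimately have "6 * ?\<chi> \<le> 5 * ?\<Delta> + 8" by linarith
    then show ?thesis ..
  next
    case True
    let ?H = "remove_max_cliques G"
    note H = pair_graph_remove_max_cliques[OF assms(3)]
      vertex_transitive_remove_max_cliques[OF assms(3,4)]
    \<comment> \<open>The number of copies exceeds \<open>max s \<omega>\<close> below, since \<open>s \<le> 1 + 5\<Delta>(H)\<close>.\<close>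
    have "\<exists>m s. 1 + ?\<omega> + 5 * max_degree ?H < m \<and> 0 < s \<and>
        (s = 1 \<or> 2 * s \<le> 5 * max_degree ?H) \<and> system_colorable s (copies m ?H)"
      by (rule ex_system_colorable_copies[OF strong H])
    then obtain m s where m: "1 + ?\<omega> + 5 * max_degree ?H < m" and s: "0 < s"
      and s_le: "s = 1 \<or> 2 * s \<le> 5 * max_degree ?H" and col: "system_colorable s (copies m ?H)"
      by (elim exE conjE)
    have "?\<chi> \<le> max s ?\<omega>"
    proof (rule chromatic_number_le_of_disjoint_max_cliques[OF assms(3,4)])
      show "A = B" if "max_clique G A" "max_clique G B" "x \<in> A" "x \<in> B" for A B x
        using max_cliques_disjoint[OF assms(3,4) True] that by blast
      show "system_colorable (max s ?\<omega>) (copies m ?H)"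
        by (rule system_colorable_mono[OF col s]) simp
      show "max s ?\<omega> < m" using m s_le by auto
    qed simp
    moreover have "max_degree ?H \<le> ?\<Delta> + 1 - ?\<omega>"
      by (rule max_degree_remove_max_cliques[OF assms(3,4)])
    ultimately show ?thesis using True s_le by (cases "s \<le> ?\<omega>") auto
  qed
  then show ?thesis
  proof
    assume "6 * ?\<chi> \<le> 5 * ?\<Delta> + 8"
    then have "6 * real ?\<chi> \<le> 5 * real ?\<Delta> + 8" by linarith
    then have "int ?\<chi> \<le> \<lceil>(5 * real ?\<Delta> + 3) / 6\<rceil>" by (simp add: le_ceiling_iff field_simps)
    then show ?thesis by simp
  qed simp
qed

end
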